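(* Let $\mathbf{p}=(p_1,\ldots,p_K)$ be a vector of prime numbers and let $\mathcal{J}\subset\mathbb{Z}^K$ be a finite set of vectors. For each $\mathbf{j}\in\mathcal{J}$ let $f_{\mathbf{j}}\in\mathcal{F}_{\mathbf{p},\mathbf{j},1}$. Then for every integer $k\geq 1$, $$\lim_{T\to\infty}\left(\frac{1}{T}\int_0^T\Big|\sum_{\mathbf{j}\in\mathcal{J}}f_{\mathbf{j}}(t)\Big|^{2k}dt\right)^{1/k}\leq (4k^2)^K\sum_{S\subseteq\{1,\dots,K\}}\ \sum_{\mathbf{j}_S\in\pi_S(\mathcal{J}_S)}\lim_{T\to\infty}\left(\frac{1}{T}\int_0^T\Big|\sum_{\mathbf{j}\in\mathcal{J}_S(\mathbf{j}_S)}f_{\mathbf{j}}(t)\Big|^{2k}dt\right)^{1/k}.$$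
   Context: For a prime $p$ and $x\in\mathbb{Q}^\times$, $v_p(x)$ is the $p$-adic valuation. For $\mathbf{p}=(p_1,\dots,p_K)$, $\mathbf{j}=(j_1,\dots,j_K)\in\mathbb{Z}^K$ and $u\in\mathbb{Q}$, $\mathcal{F}_{\mathbf{p},\mathbf{j},u}$ denotes the set of Dirichlet polynomials (finite sums) $f(t)=\sum_{n} w_n (n+u)^{it}$, where $n$ ranges over finitely many rationals with $v_{p_i}(n)=j_i$ for all $i$, the weights $w_n$ are non-negative reals, and $x^{it}=e^{it\log x}$ (the bases $n+u$ being implicitly positive). For $S\subseteq\{1,\dots,K\}$, $\pi_S$ is the projection of $\mathbb{Z}^K$ onto the coordinates indexed by $S$; $\mathcal{J}_S$ is the set of $\mathbf{j}\in\mathcal{J}$ whose non-negative entries are exactly those in the positions of $S$ (entries indexed by $S$ are $\geq 0$, entries outside $S$ are negative); and for $\mathbf{j}_S\in\pi_S(\mathcal{J})$, $\mathcal{J}_S(\mathbf{j}_S)=\{\mathbf{j}\in\mathcal{J}:\pi_S(\mathbf{j})=\mathbf{j}_S,\ \pi_{\{1,\dots,K\}\setminus S}(\mathbf{j})\in\mathbb{Z}_{<0}^{K-|S|}\}$. *)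

theory Defs
  imports "HOL-Analysis.Analysis" "HOL-Computational_Algebra.Primes" "HOL-Library.FuncSet"
begin

text \<open>
  Elements of \<open>\<int>\<^sup>K\<close> are extensional functions in \<open>{1..K} \<rightarrow>\<^sub>E UNIV\<close>, so that the projection
  \<open>\<pi>\<^sub>S\<close> onto the coordinates in \<open>S\<close> is \<open>\<lambda>j. restrict j S\<close>.
\<close>

text \<open>Only meaningful for \<open>x \<noteq> 0\<close>; the value at \<open>0\<close> is an artefact.\<close>

definition padic_val :: "nat \<Rightarrow> rat \<Rightarrow> int" where
  "padic_val p x =
     int (multiplicity (int p) (fst (quotient_of x))) -
     int (multiplicity (int p) (snd (quotient_of x)))"

definition dirichlet_polys :: "nat \<Rightarrow> (nat \<Rightarrow> nat) \<Rightarrow> (nat \<Rightarrow> int) \<Rightarrow> rat \<Rightarrow> (real \<Rightarrow> complex) set" where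
  "dirichlet_polys K p j u =
     {f. \<exists>(N :: rat set) (w :: rat \<Rightarrow> real).
           finite N \<and>
           (\<forall>n\<in>N. \<forall>i\<in>{1..K}. n \<noteq> 0 \<and> padic_val (p i) n = j i) \<and>
           (\<forall>n\<in>N. 0 < n + u) \<and>
           (\<forall>n\<in>N. 0 \<le> w n) \<and>
           f = (\<lambda>t. \<Sum>n\<in>N. complex_of_real (w n) *
                      exp (\<i> * complex_of_real (t * ln (real_of_rat (n + u)))))}"

definition nonneg_exactly :: "nat \<Rightarrow> (nat \<Rightarrow> int) set \<Rightarrow> nat set \<Rightarrow> (nat \<Rightarrow> int) set" where
  "nonneg_exactly K J S = {j \<in> J. (\<forall>i\<in>S. 0 \<le> j i) \<and> (\<forall>i\<in>{1..K} - S. j i < 0)}"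

definition fibre :: "nat \<Rightarrow> (nat \<Rightarrow> int) set \<Rightarrow> nat set \<Rightarrow> (nat \<Rightarrow> int) \<Rightarrow> (nat \<Rightarrow> int) set" where
  "fibre K J S jS = {j \<in> J. restrict j S = jS \<and> (\<forall>i\<in>{1..K} - S. j i < 0)}"

definition moment :: "nat \<Rightarrow> (real \<Rightarrow> complex) \<Rightarrow> real \<Rightarrow> real" where
  "moment k g T = (1 / T * integral {0..T} (\<lambda>t. cmod (g t) ^ (2 * k))) powr (1 / real k)"

end

theory Submission
  imports Defs
begin

text \<open>
  The mean of \<open>\<bar>f\<bar>\<^sup>2\<^sup>k\<close> is the sum of the weight products over the resonant \<open>2k\<close>-tuples, those with
  \<open>\<Prod>i<k. 1 + n\<^sub>i = \<Prod>k\<le>i<2k. 1 + n\<^sub>i\<close>. Suppose first that every \<open>n\<^sub>i\<close> is \<open>p\<close>-integral. Then the least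
  valuation among the \<open>n\<^sub>i\<close> cannot be attained exactly once: modulo the next power of \<open>p\<close> all other factors
  are \<open>1\<close>. So at least one of the \<open>k(2k-1) \<le> 2k\<^sup>2\<close> pairs of slots carries equal valuations; as the weights are
  non-negative, the mean is at most the sum over pairs and over valuations \<open>c\<close> of the mean with
  both slots restricted to valuation \<open>c\<close>, and Hoelder bounds that by
  \<open>\<parallel>f\<^sub>c\<parallel>\<^sup>2 \<parallel>f\<parallel>\<^sup>2\<^sup>k\<^sup>-\<^sup>2\<close>. Hence \<open>\<parallel>f\<parallel>\<^sup>2 \<le> 2k\<^sup>2 \<Sum>c. \<parallel>f\<^sub>c\<parallel>\<^sup>2\<close>. Terms of negative valuation are split off beforehand with
  \<open>\<bar>a + b\<bar>\<^sup>2 \<le> 2\<bar>a\<bar>\<^sup>2 + 2\<bar>b\<bar>\<^sup>2\<close>, giving the factor \<open>4k\<^sup>2\<close> for one prime; the general case is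
  induction on the number of primes.
\<close>

section \<open>Trigonometric polynomials and resonant tuples\<close>

definition trig_poly :: "('a \<Rightarrow> real) \<Rightarrow> ('a \<Rightarrow> real) \<Rightarrow> 'a set \<Rightarrow> real \<Rightarrow> complex" where
  "trig_poly w \<theta> A t = (\<Sum>a\<in>A. complex_of_real (w a) * exp (\<i> * complex_of_real (t * \<theta> a)))"

text \<open>Writing \<open>\<bar>f\<bar>^(2k)\<close> as \<open>f^k * cnj f^k\<close>, the last
  \<open>k\<close> slots are conjugated; with real weights this only negates their frequencies, so a
  sign per slot records it.\<close>

definition conj_sign :: "nat \<Rightarrow> nat \<Rightarrow> real" where
  "conj_sign k i = (if i < k then 1 else -1)"

definition resonant :: "nat \<Rightarrow> ('a \<Rightarrow> real) \<Rightarrow> (nat \<Rightarrow> 'a) \<Rightarrow> bool" where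
  "resonant k \<theta> u \<longleftrightarrow> (\<Sum>i<2*k. conj_sign k i * \<theta> (u i)) = 0"

text \<open>Each slot has its own index set, so that two slots can be confined to one valuation
  class while the others range freely.\<close>

definition energy :: "nat \<Rightarrow> ('a \<Rightarrow> real) \<Rightarrow> ('a \<Rightarrow> real) \<Rightarrow> (nat \<Rightarrow> 'a set) \<Rightarrow> real" where
  "energy k w \<theta> B = (\<Sum>u \<in> {u \<in> PiE {..<2*k} B. resonant k \<theta> u}. \<Prod>i<2*k. w (u i))"

lemma continuous_on_trig_poly [continuous_intros]:
  "continuous_on S (trig_poly w \<theta> A)"
  unfolding trig_poly_def by (intro continuous_intros)

subsection \<open>Mean values\<close>

text \<open>Orthogonality of characters: for \<open>l \<noteq> 0\<close> the exponential has a
  bounded primitive, so its integral stays bounded while \<open>T\<close> grows.\<close>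

lemma mean_exp:
  fixes l :: real
  shows "((\<lambda>T. (1 / T) *\<^sub>R integral {0..T} (\<lambda>t. exp (\<i> * complex_of_real (t * l)))) \<longlongrightarrow>
            (if l = 0 then 1 else 0)) at_top"
proof (cases "l = 0")
  case True
  have "\<forall>\<^sub>F T in at_top. (1 / T) *\<^sub>R integral {0..T} (\<lambda>t. exp (\<i> * complex_of_real (t * l))) = 1"
    using eventually_gt_at_top[of "0::real"]
    by eventually_elim (simp add: True scaleR_conv_of_real)
  then show ?thesis
    using True by (simp add: tendsto_eventually)
next
  case False
  define F where "F t = exp (\<i> * complex_of_real (t * l)) / (\<i> * complex_of_real l)" for t
  have int: "integral {0..T} (\<lambda>t. exp (\<i> * complex_of_real (t * l))) = F T - F 0" if "T > 0" for T
  proof (rule integral_unique, rule fundamental_theorem_of_calculus)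
    show "(F has_vector_derivative exp (\<i> * complex_of_real (t * l))) (at t within {0..T})" for t
    proof -
      have "((\<lambda>z. exp (\<i> * (z * of_real l)) / (\<i> * complex_of_real l)) has_field_derivative
              exp (\<i> * (of_real t * of_real l))) (at (of_real t))"
        using False by (auto intro!: derivative_eq_intros simp: field_simps)
      from has_vector_derivative_real_field[OF this] show ?thesis
        unfolding F_def of_real_mult .
    qed
  qed (use that in auto)
  have bound: "norm ((1 / T) *\<^sub>R integral {0..T} (\<lambda>t. exp (\<i> * complex_of_real (t * l)))) \<le> (2 / \<bar>l\<bar>) / T"
    if "T > 0" for T
  proof -
    have "norm (F t) = 1 / \<bar>l\<bar>" for t
      by (simp add: F_def norm_divide norm_mult)
    then have "norm (F T - F 0) \<le> 2 / \<bar>l\<bar>"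
      using norm_triangle_ineq4[of "F T" "F 0"] by simp
    then show ?thesis
      using that unfolding int[OF that] norm_scaleR by (simp add: divide_right_mono field_simps)
  qed
  have "((\<lambda>T. (2 / \<bar>l\<bar>) / T) \<longlongrightarrow> 0) at_top"
    by (intro tendsto_divide_0[OF tendsto_const] filterlim_at_top_imp_at_infinity filterlim_ident)
  then have "((\<lambda>T. (1 / T) *\<^sub>R integral {0..T} (\<lambda>t. exp (\<i> * complex_of_real (t * l)))) \<longlongrightarrow> 0) at_top"
    using eventually_mono[OF eventually_gt_at_top bound] by (rule Lim_null_comparison[rotated])
  then show ?thesis using False by simp
qed

lemma trig_poly_conj_sign:
  "trig_poly w (\<lambda>a. conj_sign k i * \<theta> a) A t = (if i < k then trig_poly w \<theta> A t else cnj (trig_poly w \<theta> A t))"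
  by (simp add: trig_poly_def conj_sign_def exp_cnj)

lemma prod_trig_poly:
  assumes "\<And>i. finite (B i)"
  shows "(\<Prod>i<2*k. trig_poly w (\<lambda>a. conj_sign k i * \<theta> a) (B i) t) =
    (\<Sum>u \<in> PiE {..<2*k} B. of_real (\<Prod>i<2*k. w (u i)) *
        exp (\<i> * of_real (t * (\<Sum>i<2*k. conj_sign k i * \<theta> (u i)))))"
proof -
  have "(\<Prod>i<2*k. trig_poly w (\<lambda>a. conj_sign k i * \<theta> a) (B i) t) =
    (\<Sum>u \<in> PiE {..<2*k} B. \<Prod>i<2*k. of_real (w (u i)) * exp (\<i> * of_real (t * (conj_sign k i * \<theta> (u i)))))"
    unfolding trig_poly_def using assms by (subst prod_sum_PiE) auto
  also have "\<dots> = (\<Sum>u \<in> PiE {..<2*k} B. of_real (\<Prod>i<2*k. w (u i)) *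
        exp (\<i> * of_real (t * (\<Sum>i<2*k. conj_sign k i * \<theta> (u i)))))"
    by (intro sum.cong refl)
       (simp add: prod.distrib exp_sum[symmetric] sum_distrib_left)
  finally show ?thesis .
qed

text \<open>Expanding the product gives one pure exponential per tuple, whose frequency is the
  signed sum; by \<open>mean_exp\<close> exactly the resonant tuples survive in the mean.\<close>

lemma mean_prod_trig_poly:
  assumes "\<And>i. finite (B i)"
  shows "((\<lambda>T. (1 / T) *\<^sub>R integral {0..T}
            (\<lambda>t. \<Prod>i<2*k. trig_poly w (\<lambda>a. conj_sign k i * \<theta> a) (B i) t)) \<longlongrightarrow>
          complex_of_real (energy k w \<theta> B)) at_top"
proof -
  let ?U = "PiE {..<2*k} B"
  let ?W = "\<lambda>u. \<Prod>i<2*k. w (u i)" and ?L = "\<lambda>u. \<Sum>i<2*k. conj_sign k i * \<theta> (u i)"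
  have fin: "finite ?U"
    using assms by (intro finite_PiE) auto
  have eq: "(1 / T) *\<^sub>R integral {0..T}
            (\<lambda>t. \<Prod>i<2*k. trig_poly w (\<lambda>a. conj_sign k i * \<theta> a) (B i) t) =
        (\<Sum>u\<in>?U. of_real (?W u) * ((1 / T) *\<^sub>R integral {0..T} (\<lambda>t. exp (\<i> * complex_of_real (t * ?L u)))))" for T
    unfolding prod_trig_poly[OF assms]
    by (subst integral_sum[OF fin])
       (auto intro!: integrable_continuous_real continuous_intros simp: scaleR_sum_right)
  have "((\<lambda>T. \<Sum>u\<in>?U. of_real (?W u) *
           ((1 / T) *\<^sub>R integral {0..T} (\<lambda>t. exp (\<i> * complex_of_real (t * ?L u))))) \<longlongrightarrow>
         (\<Sum>u\<in>?U. of_real (?W u) * (if ?L u = 0 then 1 else 0))) at_top"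
    by (intro tendsto_sum tendsto_mult tendsto_const mean_exp)
  moreover have "(\<Sum>u\<in>?U. of_real (?W u) * (if ?L u = 0 then 1 else 0)) = complex_of_real (energy k w \<theta> B)"
    unfolding energy_def of_real_sum resonant_def using fin
    by (intro sum.mono_neutral_cong_right) auto
  ultimately show ?thesis
    unfolding eq by simp
qed

lemma prod_conj_self:
  "(\<Prod>i<2*k. if i < k then z else cnj z) = complex_of_real (cmod z ^ (2 * k))"
proof -
  have "(\<Prod>i<2*k. if i < k then z else cnj z) = z ^ k * cnj z ^ k"
  proof -
    have "(\<Prod>i<2*k. if i < k then z else cnj z) =
        (\<Prod>i=0..<k. if i < k then z else cnj z) * (\<Prod>i=k..<2*k. if i < k then z else cnj z)"
      unfolding lessThan_atLeast0 by (rule prod.atLeastLessThan_concat[symmetric]) auto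
    also have "\<dots> = (\<Prod>i=0..<k. z) * (\<Prod>i=k..<2*k. cnj z)"
      by (intro arg_cong2[where f = "(*)"] prod.cong) auto
    finally show ?thesis by simp
  qed
  also have "\<dots> = complex_of_real (cmod z ^ (2 * k))"
    by (metis complex_norm_square of_real_power power_mult power_mult_distrib)
  finally show ?thesis .
qed

lemma mean_power_trig_poly:
  assumes "finite A"
  shows "((\<lambda>T. 1 / T * integral {0..T} (\<lambda>t. cmod (trig_poly w \<theta> A t) ^ (2 * k)))
            \<longlongrightarrow> energy k w \<theta> (\<lambda>_. A)) at_top"
proof -
  have "(1 / T) *\<^sub>R integral {0..T} (\<lambda>t. \<Prod>i<2*k. trig_poly w (\<lambda>a. conj_sign k i * \<theta> a) A t)
      = of_real (1 / T * integral {0..T} (\<lambda>t. cmod (trig_poly w \<theta> A t) ^ (2 * k)))" for T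
  proof -
    have "integral {0..T} (\<lambda>t. complex_of_real (cmod (trig_poly w \<theta> A t) ^ (2 * k))) =
        complex_of_real (integral {0..T} (\<lambda>t. cmod (trig_poly w \<theta> A t) ^ (2 * k)))"
      using integral_linear[OF integrable_continuous_real bounded_linear_of_real,
          of 0 T "\<lambda>t. cmod (trig_poly w \<theta> A t) ^ (2 * k)"]
      unfolding o_def by (simp add: continuous_intros)
    then show ?thesis
      unfolding trig_poly_conj_sign prod_conj_self by (simp add: scaleR_conv_of_real)
  qed
  with mean_prod_trig_poly[where B = "\<lambda>_. A" and k = k and w = w and \<theta> = \<theta>] assms show ?thesis
    by (simp only: tendsto_of_real_iff)
qed

lemma energy_nonneg:
  assumes "\<And>i a. a \<in> B i \<Longrightarrow> 0 \<le> w a"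
  shows "0 \<le> energy k w \<theta> B"
  unfolding energy_def using assms by (intro sum_nonneg prod_nonneg) (auto dest: PiE_mem)

section \<open>Moments: convergence, Hoelder's inequality and quasi-additivity\<close>

lemma moment_nonneg: "0 \<le> moment k g T"
  by (simp add: moment_def)

lemma moment_trig_poly_tendsto:
  assumes "finite A" "k \<ge> 1"
  shows "(moment k (trig_poly w \<theta> A) \<longlongrightarrow> energy k w \<theta> (\<lambda>_. A) powr (1 / real k)) at_top"
proof -
  \<comment> \<open>The limit may be 0, where a positive real power is continuous only along
    non-negative values; hence the sign is checked first.\<close>
  have "0 \<le> (1 / T * integral {0..T} (\<lambda>t. cmod (trig_poly w \<theta> A t) ^ (2 * k)))" if "T > 0" for T
    using that by (intro mult_nonneg_nonneg integral_nonneg integrable_continuous_real continuous_intros) auto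
  then show ?thesis
    unfolding moment_def using assms
    by (intro tendsto_powr2[OF mean_power_trig_poly tendsto_const])
       (auto intro: eventually_mono[OF eventually_gt_at_top[of 0]])
qed

lemma powr_root_power:
  fixes x :: real
  assumes "0 \<le> x" "k \<ge> 1"
  shows "(x powr (1 / real k)) ^ k = x"
  using assms by (cases "x = 0") (auto simp: powr_realpow[symmetric] powr_powr)

lemma moment_power:
  assumes "continuous_on {0..T} g" "T > 0" "k \<ge> 1"
  shows "moment k g T ^ k = 1 / T * integral {0..T} (\<lambda>t. cmod (g t) ^ (2 * k))"
proof -
  have "0 \<le> 1 / T * integral {0..T} (\<lambda>t. cmod (g t) ^ (2 * k))"
    using assms by (intro mult_nonneg_nonneg integral_nonneg integrable_continuous_real continuous_intros) auto
  then show ?thesis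
    unfolding moment_def using assms(3) by (rule powr_root_power)
qed

text \<open>Young's inequality in polynomial form. The case \<open>m + 1\<close> is \<open>y\<close>
  times the case \<open>m\<close> plus \<open>(x - y) * (x^(m+1) - y^(m+1)) \<ge> 0\<close>, whose
  factors have equal sign.\<close>

lemma young_power:
  fixes x y :: real
  assumes "0 \<le> x" "0 \<le> y"
  shows "real (Suc m) * (x * y ^ m) \<le> x ^ Suc m + real m * y ^ Suc m"
proof (induction m)
  case (Suc m)
  have "0 \<le> (x - y) * (x ^ Suc m - y ^ Suc m)"
    using assms power_mono[of x y "Suc m"] power_mono[of y x "Suc m"]
    by (cases "x \<le> y") (auto intro: mult_nonneg_nonneg mult_nonpos_nonpos)
  moreover have "y * (real (Suc m) * (x * y ^ m)) \<le> y * (x ^ Suc m + real m * y ^ Suc m)"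
    using Suc assms by (intro mult_left_mono) auto
  ultimately show ?case
    by (simp add: algebra_simps)
qed simp

text \<open>Hoelder with exponents \<open>k\<close> and \<open>k / (k - 1)\<close>, as
  \<open>moment\<close> is the square of a normalised \<open>2k\<close>-norm. It comes from Young's
  inequality applied pointwise to the two functions divided by their norms; this form also covers
  \<open>k = 1\<close>.\<close>

lemma moment_Hoelder:
  assumes a: "continuous_on {0..T} a" and b: "continuous_on {0..T} b"
    and "T > 0" "k \<ge> 1"
  shows "1 / T * integral {0..T} (\<lambda>t. cmod (a t) ^ 2 * cmod (b t) ^ (2 * (k - 1)))
           \<le> moment k a T * moment k b T ^ (k - 1)" (is "?I \<le> _")
proof -
  obtain m where m: "k = Suc m" using \<open>k \<ge> 1\<close> by (cases k) auto
  \<comment> \<open>A moment can vanish, so both are enlarged by \<open>e\<close> before dividing by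
    them; \<open>e\<close> tends to 0 at the end.\<close>
  have main: "?I \<le> (moment k a T + e) * (moment k b T + e) ^ m" if "e > 0" for e
  proof -
    define A where "A = moment k a T + e"
    define B where "B = moment k b T + e"
    have pos: "A > 0" "B > 0"
      using that moment_nonneg[of k a T] moment_nonneg[of k b T] by (auto simp: A_def B_def)
    have "moment k a T ^ k \<le> A ^ k" "moment k b T ^ k \<le> B ^ k"
      using that by (auto simp: A_def B_def moment_nonneg intro!: power_mono)
    then have le: "1 / T * integral {0..T} (\<lambda>t. cmod (a t) ^ (2 * k)) \<le> A ^ k"
        "1 / T * integral {0..T} (\<lambda>t. cmod (b t) ^ (2 * k)) \<le> B ^ k"
      using moment_power[OF a \<open>T > 0\<close> \<open>k \<ge> 1\<close>] moment_power[OF b \<open>T > 0\<close> \<open>k \<ge> 1\<close>] by auto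
    \<comment> \<open>Undoing the normalisation multiplies Young's inequality by
      \<open>A * B ^ m / k\<close>. After integration its two terms are at most \<open>c\<close> and
      \<open>c * m\<close>, together \<open>c * k = A * B ^ m\<close>.\<close>
    define c where "c = A * B ^ m / real k"
    have "c > 0" using pos m by (simp add: c_def)
    have pw: "cmod (a t) ^ 2 * cmod (b t) ^ (2 * m) \<le>
        c / A ^ k * cmod (a t) ^ (2 * k) + c * real m / B ^ k * cmod (b t) ^ (2 * k)" for t
    proof -
      have "cmod (a t) ^ 2 * cmod (b t) ^ (2 * m) =
          c * (real (Suc m) * ((cmod (a t) ^ 2 / A) * (cmod (b t) ^ 2 / B) ^ m))"
        using pos m by (simp add: c_def power_divide power_mult del: of_nat_Suc)
      also have "\<dots> \<le> c * ((cmod (a t) ^ 2 / A) ^ Suc m + real m * (cmod (b t) ^ 2 / B) ^ Suc m)"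
        using pos \<open>c > 0\<close> by (intro mult_left_mono young_power) auto
      also have "\<dots> = c / A ^ k * cmod (a t) ^ (2 * k) + c * real m / B ^ k * cmod (b t) ^ (2 * k)"
        unfolding m power_divide power_mult by (simp add: distrib_left)
      finally show ?thesis .
    qed
    have "integral {0..T} (\<lambda>t. cmod (a t) ^ 2 * cmod (b t) ^ (2 * m)) \<le>
        integral {0..T} (\<lambda>t. c / A ^ k * cmod (a t) ^ (2 * k) + c * real m / B ^ k * cmod (b t) ^ (2 * k))"
      using a b pos by (intro integral_le pw integrable_continuous_real continuous_intros) auto
    also have "\<dots> = c / A ^ k * integral {0..T} (\<lambda>t. cmod (a t) ^ (2 * k)) +
        c * real m / B ^ k * integral {0..T} (\<lambda>t. cmod (b t) ^ (2 * k))"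
      using a b pos by (subst integral_add) (auto intro!: integrable_continuous_real continuous_intros)
    finally have "?I \<le> 1 / T * (c / A ^ k * integral {0..T} (\<lambda>t. cmod (a t) ^ (2 * k)) +
        c * real m / B ^ k * integral {0..T} (\<lambda>t. cmod (b t) ^ (2 * k)))"
      using \<open>T > 0\<close> m by (intro mult_left_mono) auto
    also have "\<dots> = c / A ^ k * (1 / T * integral {0..T} (\<lambda>t. cmod (a t) ^ (2 * k))) +
        c * real m / B ^ k * (1 / T * integral {0..T} (\<lambda>t. cmod (b t) ^ (2 * k)))"
      by (simp add: algebra_simps)
    also have "\<dots> \<le> c / A ^ k * A ^ k + c * real m / B ^ k * B ^ k"
      using pos \<open>c > 0\<close> le by (intro add_mono mult_left_mono) auto
    also have "\<dots> = c * real k"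
      using pos m by (simp add: algebra_simps)
    also have "\<dots> = A * B ^ m" using m by (simp add: c_def)
    finally show ?thesis by (simp add: A_def B_def)
  qed
  have "((\<lambda>e. (moment k a T + e) * (moment k b T + e) ^ m) \<longlongrightarrow>
      (moment k a T + 0) * (moment k b T + 0) ^ m) (at_right 0)"
    by (intro tendsto_intros)
  moreover have "\<forall>\<^sub>F e in at_right 0. ?I \<le> (moment k a T + e) * (moment k b T + e) ^ m"
    using main by (intro eventually_at_rightI[of 0 1]) auto
  ultimately have "?I \<le> (moment k a T + 0) * (moment k b T + 0) ^ m"
    by (intro tendsto_lowerbound) (auto simp: trivial_limit_at_right_real)
  then show ?thesis using m by simp
qed

text \<open>Two of the \<open>2k\<close> factors of \<open>\<bar>a + b\<bar>^(2k)\<close> are split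
  by the parallelogram bound; Hoelder against the remaining ones leaves \<open>?M ^ (k - 1)\<close>
  on both sides, which cancels.\<close>

lemma moment_add_le:
  assumes "continuous_on {0..T} a" "continuous_on {0..T} b" "T > 0" "k \<ge> 1"
  shows "moment k (\<lambda>t. a t + b t) T \<le> 2 * (moment k a T + moment k b T)"
proof -
  let ?f = "\<lambda>t. a t + b t"
  let ?M = "moment k ?f T"
  have f: "continuous_on {0..T} ?f" using assms by (intro continuous_intros)
  obtain m where m: "k = Suc m" using \<open>k \<ge> 1\<close> by (cases k) auto
  have sq: "cmod (a t + b t) ^ 2 \<le> 2 * cmod (a t) ^ 2 + 2 * cmod (b t) ^ 2" for t
  proof -
    have "cmod (a t + b t) ^ 2 \<le> (cmod (a t) + cmod (b t)) ^ 2"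
      by (intro power_mono norm_triangle_ineq) auto
    also have "\<dots> \<le> 2 * cmod (a t) ^ 2 + 2 * cmod (b t) ^ 2"
      using zero_le_power2[of "cmod (a t) - cmod (b t)"] by (simp add: power2_eq_square algebra_simps)
    finally show ?thesis .
  qed
  have pw: "cmod (?f t) ^ (2 * k) \<le> 2 * (cmod (a t) ^ 2 * cmod (?f t) ^ (2 * (k - 1))) +
      2 * (cmod (b t) ^ 2 * cmod (?f t) ^ (2 * (k - 1)))" for t
    using mult_right_mono[OF sq[of t], of "cmod (?f t) ^ (2 * m)"]
    by (simp add: m power_add power2_eq_square algebra_simps)
  have "?M * ?M ^ m = 1 / T * integral {0..T} (\<lambda>t. cmod (?f t) ^ (2 * k))"
    using moment_power[OF f assms(3,4)] m by simp
  also have "\<dots> \<le> 1 / T * integral {0..T} (\<lambda>t. 2 * (cmod (a t) ^ 2 * cmod (?f t) ^ (2 * (k - 1))) +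
      2 * (cmod (b t) ^ 2 * cmod (?f t) ^ (2 * (k - 1))))"
    using assms by (intro mult_left_mono integral_le pw integrable_continuous_real continuous_intros) auto
  also have "\<dots> = 2 * (1 / T * integral {0..T} (\<lambda>t. cmod (a t) ^ 2 * cmod (?f t) ^ (2 * (k - 1)))) +
      2 * (1 / T * integral {0..T} (\<lambda>t. cmod (b t) ^ 2 * cmod (?f t) ^ (2 * (k - 1))))"
    using assms by (subst integral_add)
      (auto intro!: integrable_continuous_real continuous_intros simp: algebra_simps)
  also have "\<dots> \<le> 2 * (moment k a T * ?M ^ (k - 1)) + 2 * (moment k b T * ?M ^ (k - 1))"
    using moment_Hoelder[OF assms(1) f assms(3,4)] moment_Hoelder[OF assms(2) f assms(3,4)] by linarith
  also have "\<dots> = (2 * (moment k a T + moment k b T)) * ?M ^ m"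
    using m by (simp add: algebra_simps)
  finally have *: "?M * ?M ^ m \<le> (2 * (moment k a T + moment k b T)) * ?M ^ m" .
  show ?thesis
  proof (cases "?M = 0")
    case True
    then show ?thesis using moment_nonneg[of k a T] moment_nonneg[of k b T] by simp
  next
    case False
    then have "?M ^ m > 0" using moment_nonneg[of k ?f T] by simp
    then show ?thesis using * by (simp only: mult_le_cancel_right_pos)
  qed
qed


subsection \<open>Combinatorics of resonant tuples\<close>

text \<open>The square of the seminorm \<open>\<parallel>f\<parallel> = lim\<^sub>T (1/T \<integral>\<bar>f\<bar>\<^sup>2\<^sup>k)\<^bsup>1/2k\<^esup>\<close>, the limit of \<^const>\<open>moment\<close>.\<close>

definition mean_sq_norm :: "nat \<Rightarrow> ('a \<Rightarrow> real) \<Rightarrow> ('a \<Rightarrow> real) \<Rightarrow> 'a set \<Rightarrow> real" where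
  "mean_sq_norm k w \<theta> A = energy k w \<theta> (\<lambda>_. A) powr (1 / real k)"

lemma mean_sq_norm_nonneg: "0 \<le> mean_sq_norm k w \<theta> A"
  by (simp add: mean_sq_norm_def)

lemma mean_sq_norm_power:
  assumes "\<And>a. a \<in> A \<Longrightarrow> 0 \<le> w a" "k \<ge> 1"
  shows "mean_sq_norm k w \<theta> A ^ k = energy k w \<theta> (\<lambda>_. A)"
  unfolding mean_sq_norm_def using assms by (intro powr_root_power energy_nonneg)

text \<open>With \<open>k \<ge> 1\<close> there is a slot that cannot be filled; for
  \<open>k = 0\<close> the empty tuple would count.\<close>

lemma mean_sq_norm_empty: "k \<ge> 1 \<Longrightarrow> mean_sq_norm k w \<theta> {} = 0"
  by (force simp: mean_sq_norm_def energy_def PiE_iff intro!: sum.neutral)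

lemma mean_sq_norm_split:
  assumes "finite A" "k \<ge> 1"
  shows "mean_sq_norm k w \<theta> A \<le>
    2 * (mean_sq_norm k w \<theta> {a \<in> A. P a} + mean_sq_norm k w \<theta> {a \<in> A. \<not> P a})"
proof -
  let ?g = "trig_poly w \<theta>"
  have "A = {a \<in> A. P a} \<union> {a \<in> A. \<not> P a}" by blast
  then have "?g A = (\<lambda>t. ?g {a \<in> A. P a} t + ?g {a \<in> A. \<not> P a} t)"
    using assms(1) by (subst \<open>A = _\<close>, unfold trig_poly_def, subst sum.union_disjoint) auto
  then have "moment k (?g A) T \<le> 2 * (moment k (?g {a \<in> A. P a}) T + moment k (?g {a \<in> A. \<not> P a}) T)"
    if "T > 0" for T
    using that assms(2) by (simp only:) (intro moment_add_le continuous_intros)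
  then have "\<forall>\<^sub>F T in at_top. moment k (?g A) T \<le>
      2 * (moment k (?g {a \<in> A. P a}) T + moment k (?g {a \<in> A. \<not> P a}) T)"
    by (auto intro: eventually_mono[OF eventually_gt_at_top[of 0]])
  then show ?thesis
    unfolding mean_sq_norm_def using assms
    by (intro tendsto_le[OF trivial_limit_at_top_linorder _ moment_trig_poly_tendsto])
       (auto intro!: tendsto_intros moment_trig_poly_tendsto)
qed

text \<open>Conjugation does not change the modulus, so wherever \<open>r\<close> and
  \<open>s\<close> lie the product has modulus
  \<open>\<bar>f_C\<bar>^2 * \<bar>f_A\<bar>^(2(k-1))\<close>. Hoelder bounds its mean for each
  \<open>T\<close>, and the energy is the limit of that mean.\<close>

lemma energy_two_slots_le:
  assumes "finite A" "C \<subseteq> A" "r < s" "s < 2 * k"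
  shows "energy k w \<theta> (\<lambda>i. if i \<in> {r, s} then C else A)
    \<le> mean_sq_norm k w \<theta> C * mean_sq_norm k w \<theta> A ^ (k - 1)"
proof -
  define B where "B i = (if i \<in> {r, s} then C else A)" for i
  let ?h = "\<lambda>t. \<Prod>i<2*k. trig_poly w (\<lambda>a. conj_sign k i * \<theta> a) (B i) t"
  have k: "k \<ge> 1" using assms by simp
  have finC: "finite C" using assms finite_subset by blast
  have finB: "finite (B i)" for i using assms finC by (simp add: B_def)
  have norm_h: "norm (?h t) = cmod (trig_poly w \<theta> C t) ^ 2 * cmod (trig_poly w \<theta> A t) ^ (2 * (k - 1))" for t
  proof -
    have "norm (?h t) = (\<Prod>i<2*k. if i \<in> {r, s} then cmod (trig_poly w \<theta> C t) else cmod (trig_poly w \<theta> A t))"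
      unfolding prod_norm[symmetric] trig_poly_conj_sign
      by (intro prod.cong) (auto simp: B_def)
    also have "\<dots> = cmod (trig_poly w \<theta> C t) ^ card {r, s} * cmod (trig_poly w \<theta> A t) ^ card ({..<2*k} - {r, s})"
    proof -
      have "{..<2*k} \<inter> {i. i \<in> {r, s}} = {r, s}" "{..<2*k} \<inter> - {i. i \<in> {r, s}} = {..<2*k} - {r, s}"
        using assms by auto
      then show ?thesis
        by (subst prod.If_cases) simp_all
    qed
    also have "card ({..<2*k} - {r, s}) = 2 * (k - 1)"
      using assms by (subst card_Diff_subset) auto
    finally show ?thesis using assms by (simp add: power2_eq_square)
  qed
  \<comment> \<open>For finite \<open>T\<close> the mean is complex and only its limit is known to
    be real; real parts make the comparison with the norm possible.\<close>
  have "((\<lambda>T. Re ((1 / T) *\<^sub>R integral {0..T} ?h)) \<longlongrightarrow> Re (complex_of_real (energy k w \<theta> B))) at_top"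
    by (intro tendsto_Re mean_prod_trig_poly finB)
  then have lim: "((\<lambda>T. Re ((1 / T) *\<^sub>R integral {0..T} ?h)) \<longlongrightarrow> energy k w \<theta> B) at_top" by simp
  have le: "Re ((1 / T) *\<^sub>R integral {0..T} ?h) \<le>
      moment k (trig_poly w \<theta> C) T * moment k (trig_poly w \<theta> A) T ^ (k - 1)" if "T > 0" for T
  proof -
    have "Re ((1 / T) *\<^sub>R integral {0..T} ?h) \<le> norm ((1 / T) *\<^sub>R integral {0..T} ?h)"
      by (rule complex_Re_le_cmod)
    also have "\<dots> = 1 / T * norm (integral {0..T} ?h)"
      using that by simp
    also have "\<dots> \<le> 1 / T * integral {0..T}
        (\<lambda>t. cmod (trig_poly w \<theta> C t) ^ 2 * cmod (trig_poly w \<theta> A t) ^ (2 * (k - 1)))"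
      using that by (intro mult_left_mono integral_norm_bound_integral integrable_continuous_real
          continuous_intros) (auto simp: norm_h)
    also have "\<dots> \<le> moment k (trig_poly w \<theta> C) T * moment k (trig_poly w \<theta> A) T ^ (k - 1)"
      using that k by (intro moment_Hoelder continuous_intros)
    finally show ?thesis .
  qed
  have "energy k w \<theta> B \<le> mean_sq_norm k w \<theta> C * mean_sq_norm k w \<theta> A ^ (k - 1)"
  proof (rule tendsto_le[OF trivial_limit_at_top_linorder _ lim])
    show "((\<lambda>T. moment k (trig_poly w \<theta> C) T * moment k (trig_poly w \<theta> A) T ^ (k - 1)) \<longlongrightarrow>
        mean_sq_norm k w \<theta> C * mean_sq_norm k w \<theta> A ^ (k - 1)) at_top"
      unfolding mean_sq_norm_def
      by (intro tendsto_mult tendsto_power moment_trig_poly_tendsto k finC assms(1))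
    show "\<forall>\<^sub>F T in at_top. Re ((1 / T) *\<^sub>R integral {0..T} ?h) \<le>
        moment k (trig_poly w \<theta> C) T * moment k (trig_poly w \<theta> A) T ^ (k - 1)"
      using le by (auto intro: eventually_mono[OF eventually_gt_at_top[of 0]])
  qed
  then show ?thesis by (simp add: B_def[abs_def])
qed

lemma sum_lessThan_id_le: "2 * (\<Sum>s<n. s) \<le> n * (n :: nat)"
  by (induction n) auto

text \<open>A union bound over two slots and their common value \<open>c\<close>. Non-negative
  weights make it harmless to count a tuple several times, and only the existence of a coincidence
  in every resonant tuple is asked of \<open>v\<close>.\<close>

lemma mean_sq_norm_le_of_coincidence:
  fixes v :: "'a \<Rightarrow> 'b"
  assumes "finite A" and w: "\<And>a. a \<in> A \<Longrightarrow> 0 \<le> w a" and "k \<ge> 1"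
    and coin: "\<And>u. u \<in> {..<2*k} \<rightarrow> A \<Longrightarrow> resonant k \<theta> u \<Longrightarrow> \<exists>r s. r < s \<and> s < 2 * k \<and> v (u r) = v (u s)"
  shows "mean_sq_norm k w \<theta> A \<le> 2 * real k ^ 2 * (\<Sum>c\<in>v ` A. mean_sq_norm k w \<theta> {a \<in> A. v a = c})"
proof -
  define N where "N = mean_sq_norm k w \<theta> A"
  define \<Sigma> where "\<Sigma> = (\<Sum>c\<in>v ` A. mean_sq_norm k w \<theta> {a \<in> A. v a = c})"
  define P where "P = (SIGMA s:{..<2*k}. {..<s})"
  \<comment> \<open>\<open>q\<close> names the larger slot, the smaller slot and the common value;
    \<open>B q\<close> confines these two slots to the class of \<open>c\<close>.\<close>
  define B where "B q i = (case q of ((s, r), c) \<Rightarrow> if i \<in> {r, s} then {a \<in> A. v a = c} else A)"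
    for q :: "(nat \<times> nat) \<times> 'b" and i :: nat
  define Y where "Y q = {u \<in> PiE {..<2*k} (B q). resonant k \<theta> u}" for q
  have N0: "0 \<le> N" and \<Sigma>0: "0 \<le> \<Sigma>"
    by (auto simp: N_def \<Sigma>_def mean_sq_norm_nonneg sum_nonneg)
  have finP: "finite P" by (simp add: P_def)
  \<comment> \<open>There are \<open>k * (2 * k - 1)\<close> pairs of slots; this is the source of
    the constant \<open>2 * k^2\<close>.\<close>
  have cardP: "real (card P) \<le> 2 * real k ^ 2"
  proof -
    have "card P = (\<Sum>s<2*k. s)" by (simp add: P_def)
    then have "card P \<le> 2 * k ^ 2"
      using sum_lessThan_id_le[of "2*k"] by (simp add: power2_eq_square)
    then have "real (card P) \<le> real (2 * k ^ 2)" by (rule of_nat_mono)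
    then show ?thesis by simp
  qed
  have BA: "B q i \<subseteq> A" for q i by (auto simp: B_def split: prod.splits)
  have finY: "finite (Y q)" for q
  proof -
    have "finite (PiE {..<2*k} (B q))"
      using BA finite_subset[OF BA assms(1)] by (intro finite_PiE) auto
    then show ?thesis by (simp add: Y_def)
  qed
  have finX: "finite {u \<in> PiE {..<2*k} (\<lambda>_. A). resonant k \<theta> u}"
    using finite_PiE[of "{..<2*k}" "\<lambda>_. A"] assms(1) by simp
  have "N ^ k = energy k w \<theta> (\<lambda>_. A)"
    unfolding N_def using w assms(3) by (rule mean_sq_norm_power)
  also have "\<dots> \<le> (\<Sum>(q, u)\<in>Sigma (P \<times> v ` A) Y. \<Prod>i<2*k. w (u i))"
    unfolding energy_def
  \<comment> \<open>Each resonant tuple is the second component of at least one tagged pair, tagged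
    by a coincidence that it has.\<close>
  proof (rule sum_le_included[where i = snd])
    show "\<forall>y\<in>Sigma (P \<times> v ` A) Y. 0 \<le> (case y of (q, u) \<Rightarrow> \<Prod>i<2*k. w (u i))"
    proof safe
      fix s r c u assume "u \<in> Y ((s, r), c)"
      then have "u i \<in> A" if "i < 2 * k" for i
        using that subsetD[OF BA, of "u i" "((s, r), c)" i] by (auto simp: Y_def dest!: PiE_mem)
      then show "0 \<le> (\<Prod>i<2*k. w (u i))" using w by (intro prod_nonneg) auto
    qed
    show "\<forall>u\<in>{u \<in> PiE {..<2*k} (\<lambda>_. A). resonant k \<theta> u}. \<exists>y\<in>Sigma (P \<times> v ` A) Y.
        snd y = u \<and> (\<Prod>i<2*k. w (u i)) \<le> (case y of (q, u) \<Rightarrow> \<Prod>i<2*k. w (u i))"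
    proof
      fix u assume "u \<in> {u \<in> PiE {..<2*k} (\<lambda>_. A). resonant k \<theta> u}"
      then have u: "u \<in> PiE {..<2*k} (\<lambda>_. A)" "resonant k \<theta> u" by auto
      then obtain r s where rs: "r < s" "s < 2 * k" "v (u r) = v (u s)"
        using coin[of u] by (auto simp: PiE_def)
      have uA: "u i \<in> A" if "i < 2 * k" for i using u(1) that by (auto dest: PiE_mem)
      have "u i \<in> B ((s, r), v (u s)) i" if "i < 2 * k" for i
        using uA[OF that] rs by (auto simp: B_def)
      then have "u \<in> PiE {..<2*k} (B ((s, r), v (u s)))"
        using u(1) by (auto simp: PiE_iff)
      then have "(((s, r), v (u s)), u) \<in> Sigma (P \<times> v ` A) Y"
        using rs u uA by (auto simp: P_def Y_def)
      then show "\<exists>y\<in>Sigma (P \<times> v ` A) Y.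
        snd y = u \<and> (\<Prod>i<2*k. w (u i)) \<le> (case y of (q, u) \<Rightarrow> \<Prod>i<2*k. w (u i))"
        by force
    qed
  qed (use finX finP finY assms(1) in auto)
  also have "\<dots> = (\<Sum>q\<in>P \<times> v ` A. energy k w \<theta> (B q))"
    unfolding energy_def Y_def[symmetric]
    using finP finY assms(1) by (subst sum.Sigma) auto
  also have "\<dots> \<le> (\<Sum>(sr, c)\<in>P \<times> v ` A. mean_sq_norm k w \<theta> {a \<in> A. v a = c} * N ^ (k - 1))"
  proof (rule sum_mono)
    fix q assume "q \<in> P \<times> v ` A"
    then obtain s r c where q: "q = ((s, r), c)" "r < s" "s < 2 * k"
      by (auto simp: P_def)
    have "energy k w \<theta> (\<lambda>i. if i \<in> {r, s} then {a \<in> A. v a = c} else A) \<le>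
        mean_sq_norm k w \<theta> {a \<in> A. v a = c} * N ^ (k - 1)"
      unfolding N_def using q assms(1) by (intro energy_two_slots_le) auto
    moreover have "B q = (\<lambda>i. if i \<in> {r, s} then {a \<in> A. v a = c} else A)"
      by (rule ext) (simp add: B_def q)
    ultimately show "energy k w \<theta> (B q) \<le>
        (case q of (sr, c) \<Rightarrow> mean_sq_norm k w \<theta> {a \<in> A. v a = c} * N ^ (k - 1))"
      using q(1) by simp
  qed
  also have "\<dots> = real (card P) * (\<Sigma> * N ^ (k - 1))"
    by (subst sum.cartesian_product[symmetric]) (simp add: \<Sigma>_def sum_distrib_right)
  also have "\<dots> \<le> 2 * real k ^ 2 * (\<Sigma> * N ^ (k - 1))"
    using cardP N0 \<Sigma>0 by (intro mult_right_mono) auto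
  finally have *: "N ^ k \<le> 2 * real k ^ 2 * \<Sigma> * N ^ (k - 1)" by (simp add: mult.assoc)
  \<comment> \<open>Divide by \<open>N ^ (k - 1)\<close>; the case \<open>N = 0\<close> is trivial
    because the right side is non-negative.\<close>
  have "N \<le> 2 * real k ^ 2 * \<Sigma>"
  proof (cases "N = 0")
    case True
    then show ?thesis using \<Sigma>0 by simp
  next
    case False
    then have "N ^ (k - 1) > 0" using N0 by simp
    moreover have "N ^ k = N * N ^ (k - 1)"
      using \<open>k \<ge> 1\<close> by (cases k) auto
    ultimately show ?thesis using * by (simp only: mult_le_cancel_right_pos)
  qed
  then show ?thesis by (simp add: N_def \<Sigma>_def)
qed

subsection \<open>Valuations\<close>

text \<open>The ideal generated by \<open>p^m\<close> in the localisation of the integers at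
  \<open>p\<close>. Unlike a condition on \<open>padic_val\<close>, membership is meaningful at 0
  and so is stable under sums and differences.\<close>

definition padic_ideal :: "int \<Rightarrow> nat \<Rightarrow> rat set" where
  "padic_ideal p m = {x. \<exists>a b. \<not> p dvd b \<and> x = of_int (p ^ m * a) / of_int b}"

lemma padic_idealI: "\<not> p dvd b \<Longrightarrow> x = of_int (p ^ m * a) / of_int b \<Longrightarrow> x \<in> padic_ideal p m"
  by (auto simp: padic_ideal_def)

lemma padic_idealE:
  assumes "x \<in> padic_ideal p m"
  obtains a b where "\<not> p dvd b" "b \<noteq> 0" "x = of_int (p ^ m * a) / of_int b"
  using assms by (fastforce simp: padic_ideal_def)

lemma padic_ideal_zero: "prime p \<Longrightarrow> 0 \<in> padic_ideal p m"
  by (rule padic_idealI[of _ 1 _ _ 0]) (auto simp: not_prime_unit)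

lemma padic_ideal_add:
  assumes "prime p" "x \<in> padic_ideal p m" "y \<in> padic_ideal p m"
  shows "x + y \<in> padic_ideal p m"
proof -
  obtain a b where x: "\<not> p dvd b" "b \<noteq> 0" "x = of_int (p ^ m * a) / of_int b"
    using assms(2) by (rule padic_idealE)
  obtain c d where y: "\<not> p dvd d" "d \<noteq> 0" "y = of_int (p ^ m * c) / of_int d"
    using assms(3) by (rule padic_idealE)
  show ?thesis
  proof (rule padic_idealI)
    show "\<not> p dvd b * d" using assms(1) x y by (simp add: prime_dvd_mult_iff)
    show "x + y = of_int (p ^ m * (a * d + c * b)) / of_int (b * d)"
      using x y by (simp add: field_simps)
  qed
qed

lemma padic_ideal_mult:
  assumes "prime p" "x \<in> padic_ideal p l" "y \<in> padic_ideal p m"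
  shows "x * y \<in> padic_ideal p m"
proof -
  obtain a b where x: "\<not> p dvd b" "b \<noteq> 0" "x = of_int (p ^ l * a) / of_int b"
    using assms(2) by (rule padic_idealE)
  obtain c d where y: "\<not> p dvd d" "d \<noteq> 0" "y = of_int (p ^ m * c) / of_int d"
    using assms(3) by (rule padic_idealE)
  show ?thesis
  proof (rule padic_idealI)
    show "\<not> p dvd b * d" using assms(1) x y by (simp add: prime_dvd_mult_iff)
    show "x * y = of_int (p ^ m * (p ^ l * a * c)) / of_int (b * d)"
      using x y by (simp add: field_simps)
  qed
qed

lemma padic_ideal_uminus: "x \<in> padic_ideal p m \<Longrightarrow> - x \<in> padic_ideal p m"
  by (erule padic_idealE, rule_tac a = "- a" in padic_idealI) auto

lemma padic_ideal_diff:
  "prime p \<Longrightarrow> x \<in> padic_ideal p m \<Longrightarrow> y \<in> padic_ideal p m \<Longrightarrow> x - y \<in> padic_ideal p m"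
  using padic_ideal_add[OF _ _ padic_ideal_uminus] by force

text \<open>Multiplicativity of the congruence to 1 modulo \<open>p^m\<close>, from
  \<open>P * (1 + x) - 1 = (P - 1) + x + x * (P - 1)\<close>.\<close>

lemma prod_one_plus_padic_ideal:
  assumes "prime p" "finite F" "\<And>i. i \<in> F \<Longrightarrow> n i \<in> padic_ideal p m"
  shows "(\<Prod>i\<in>F. 1 + n i) - 1 \<in> padic_ideal p m"
  using assms(2,3)
proof (induction F)
  case empty
  then show ?case using assms(1) by (simp add: padic_ideal_zero)
next
  case (insert i F)
  let ?P = "\<Prod>i\<in>F. 1 + n i"
  have "(\<Prod>i\<in>insert i F. 1 + n i) - 1 = (?P - 1) + (n i + n i * (?P - 1))"
    using insert by (simp add: algebra_simps)
  also have "\<dots> \<in> padic_ideal p m"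
    using insert assms(1) by (intro padic_ideal_add padic_ideal_mult) auto
  finally show ?case .
qed

lemma padic_ideal_of_padic_val:
  assumes "prime p" "x \<noteq> 0" "int m \<le> padic_val p x"
  shows "x \<in> padic_ideal (int p) m"
proof -
  obtain a b where q: "quotient_of x = (a, b)" by (cases "quotient_of x")
  have b: "b > 0" "coprime a b" "x = of_int a / of_int b"
    using q by (auto simp: quotient_of_denom_pos quotient_of_coprime quotient_of_div)
  have v: "padic_val p x = int (multiplicity (int p) a) - int (multiplicity (int p) b)"
    by (simp add: padic_val_def q)
  \<comment> \<open>In lowest terms \<open>p\<close> cannot divide both parts, so a \<open>p\<close>
    in the denominator would make the valuation negative.\<close>
  have ndvd: "\<not> int p dvd b"
  proof
    assume dvd: "int p dvd b"
    then have "\<not> int p dvd a"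
      using b(2) assms(1) by (meson coprime_common_divisor not_prime_unit prime_int_nat_transfer prime_nat_int_transfer)
    then have "multiplicity (int p) a = 0" by (rule not_dvd_imp_multiplicity_0)
    moreover have "multiplicity (int p) b > 0"
      using dvd b(1) assms(1) by (simp add: prime_multiplicity_gt_zero_iff)
    ultimately show False using v assms(3) by simp
  qed
  then have "m \<le> multiplicity (int p) a"
    using v assms(3) by (simp add: not_dvd_imp_multiplicity_0)
  then have "int p ^ m dvd a" by (rule multiplicity_dvd')
  then obtain a' where "a = int p ^ m * a'" by (auto elim: dvdE)
  with ndvd b(3) show ?thesis by (auto intro: padic_idealI)
qed

lemma padic_val_of_padic_ideal:
  assumes "prime p" "x \<noteq> 0" "x \<in> padic_ideal (int p) m" "0 \<le> padic_val p x"
  shows "int m \<le> padic_val p x"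
proof -
  obtain a b where q: "quotient_of x = (a, b)" by (cases "quotient_of x")
  have b: "b > 0" "coprime a b" "x = of_int a / of_int b"
    using q by (auto simp: quotient_of_denom_pos quotient_of_coprime quotient_of_div)
  have a0: "a \<noteq> 0" using b assms(2) by auto
  obtain c d where x: "\<not> int p dvd d" "d \<noteq> 0" "x = of_int (int p ^ m * c) / of_int d"
    using assms(3) by (rule padic_idealE)
  have pp: "prime (int p)" using assms(1) by simp
  have "of_int (a * d) = (of_int (int p ^ m * c * b) :: rat)"
    using b(1,3) x by (simp add: field_simps)
  then have "a * d = int p ^ m * c * b" by (simp only: of_int_eq_iff)
  then have "int p ^ m dvd a * d" by simp
  moreover have "coprime (int p ^ m) d"
    using prime_imp_power_coprime[OF pp x(1)] by (simp add: coprime_commute)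
  ultimately have "int p ^ m dvd a" by (simp add: coprime_dvd_mult_left_iff)
  then have m: "m \<le> multiplicity (int p) a"
    using a0 pp by (intro multiplicity_geI) auto
  \<comment> \<open>For \<open>m > 0\<close> the numerator is divisible by \<open>p\<close>, so the
    reduced denominator is not; for \<open>m = 0\<close> the claim is the last hypothesis.\<close>
  have "multiplicity (int p) b = 0" if "m > 0"
  proof -
    have "int p dvd a" using \<open>int p ^ m dvd a\<close> that by (meson dvd_power dvd_trans)
    then have "\<not> int p dvd b"
      using b(2) pp by (meson coprime_common_divisor not_prime_unit)
    then show ?thesis by (rule not_dvd_imp_multiplicity_0)
  qed
  then show ?thesis using m assms(4) by (cases "m = 0") (auto simp: padic_val_def q)
qed

lemma prod_one_plus_neq:
  assumes "prime p" "finite F" "finite G" "i0 \<in> F"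
    and "n i0 \<in> padic_ideal p 0" "n i0 \<notin> padic_ideal p m"
    and "\<And>i. i \<in> F \<union> G - {i0} \<Longrightarrow> n i \<in> padic_ideal p m" "i0 \<notin> G"
  shows "(\<Prod>i\<in>F. 1 + n i) \<noteq> (\<Prod>i\<in>G. 1 + n i)"
proof
  assume eq: "(\<Prod>i\<in>F. 1 + n i) = (\<Prod>i\<in>G. 1 + n i)"
  define y where "y = (\<Prod>i\<in>F - {i0}. 1 + n i) - 1"
  define z where "z = (\<Prod>i\<in>G. 1 + n i) - 1"
  have yz: "y \<in> padic_ideal p m" "z \<in> padic_ideal p m"
    unfolding y_def z_def using assms by (auto intro!: prod_one_plus_padic_ideal)
  \<comment> \<open>Modulo \<open>p^m\<close> every other factor is 1, so equality would force
    \<open>n i0\<close> into the ideal. Solving for \<open>n i0\<close> shows this; its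
    \<open>p\<close>-integrality keeps \<open>n i0 * y\<close> in the ideal.\<close>
  have "(1 + n i0) * (1 + y) = 1 + z"
    using eq prod.remove[OF assms(2,4), of "\<lambda>i. 1 + n i"] by (simp add: y_def z_def)
  then have "n i0 = z - y - n i0 * y" by (simp add: algebra_simps)
  moreover have "z - y - n i0 * y \<in> padic_ideal p m"
    using assms yz by (intro padic_ideal_diff padic_ideal_mult[of _ _ 0]) auto
  ultimately show False using assms by simp
qed

lemma ex_equal_padic_val:
  assumes p: "prime p" and fin: "finite F" "finite G" and disj: "F \<inter> G = {}" "F \<union> G \<noteq> {}"
    and n: "\<And>i. i \<in> F \<union> G \<Longrightarrow> n i \<noteq> 0 \<and> 0 \<le> padic_val p (n i)"
    and eq: "(\<Prod>i\<in>F. 1 + n i) = (\<Prod>i\<in>G. 1 + n i)"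
  shows "\<exists>r\<in>F \<union> G. \<exists>s\<in>F \<union> G. r \<noteq> s \<and> padic_val p (n r) = padic_val p (n s)"
proof (rule ccontr)
  assume neg: "\<not> ?thesis"
  define v where "v i = padic_val p (n i)" for i
  have "Min (v ` (F \<union> G)) \<in> v ` (F \<union> G)" using fin disj by (intro Min_in) auto
  then obtain i0 where i0: "i0 \<in> F \<union> G" "v i0 = Min (v ` (F \<union> G))" by (metis imageE)
  have less: "v i0 < v i" if "i \<in> F \<union> G - {i0}" for i
  proof -
    have "v i0 \<le> v i" using fin that i0 by auto
    moreover have "v i0 \<noteq> v i"
    proof
      assume "v i0 = v i"
      moreover have "i \<in> F \<union> G" "i0 \<noteq> i" using that by auto
      ultimately show False using neg i0(1) unfolding v_def by metis
    qed
    ultimately show ?thesis by simp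
  qed
  \<comment> \<open>One power above the minimum: \<open>n i0\<close> is nonzero modulo
    \<open>p^m\<close>, while all strictly larger valuations vanish there.\<close>
  define m where "m = nat (v i0) + 1"
  have v0: "0 \<le> v i0" using n[OF i0(1)] by (simp add: v_def)
  have 1: "n i0 \<in> padic_ideal (int p) 0"
    using p n[OF i0(1)] by (intro padic_ideal_of_padic_val) auto
  have 2: "n i0 \<notin> padic_ideal (int p) m"
    using padic_val_of_padic_ideal[OF p, of "n i0" m] n[OF i0(1)] by (auto simp: m_def v_def)
  have 3: "n i \<in> padic_ideal (int p) m" if "i \<in> F \<union> G - {i0}" for i
    using p n[of i] that less[OF that] v0 by (intro padic_ideal_of_padic_val) (auto simp: m_def v_def)
  have pp: "prime (int p)" using p by simp
  show False
  \<comment> \<open>The exceptional index may lie in either product; the argument is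
    symmetric.\<close>
  proof (cases "i0 \<in> F")
    case True
    have "(\<Prod>i\<in>F. 1 + n i) \<noteq> (\<Prod>i\<in>G. 1 + n i)"
      by (rule prod_one_plus_neq[where n = n, OF pp fin(1,2) True 1 2]) (use 3 True disj in auto)
    then show False using eq by blast
  next
    case False
    then have G: "i0 \<in> G" using i0(1) by blast
    have "(\<Prod>i\<in>G. 1 + n i) \<noteq> (\<Prod>i\<in>F. 1 + n i)"
      by (rule prod_one_plus_neq[where n = n, OF pp fin(2,1) G 1 2]) (use 3 False in auto)
    then show False using eq by simp
  qed
qed

text \<open>Exponentiating a vanishing signed sum of logarithms gives a multiplicative equation;
  injectivity of the embedding brings it back to the rationals, where valuations apply.\<close>

lemma resonant_prod_eq:
  assumes "\<And>i. i < 2 * k \<Longrightarrow> 0 < x (u i)"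
    and "resonant k (\<lambda>a. ln (real_of_rat (x a))) u"
  shows "(\<Prod>i<k. x (u i)) = (\<Prod>i=k..<2*k. x (u i))"
proof -
  let ?l = "\<lambda>i. ln (real_of_rat (x (u i)))"
  have "0 = (\<Sum>i<2*k. conj_sign k i * ?l i)"
    using assms(2) by (simp add: resonant_def)
  also have "\<dots> = (\<Sum>i=0..<k. conj_sign k i * ?l i) + (\<Sum>i=k..<2*k. conj_sign k i * ?l i)"
    unfolding lessThan_atLeast0 by (rule sum.atLeastLessThan_concat[symmetric]) auto
  also have "\<dots> = (\<Sum>i=0..<k. ?l i) + (\<Sum>i=k..<2*k. - ?l i)"
    by (intro arg_cong2[where f = "(+)"] sum.cong) (auto simp: conj_sign_def)
  finally have "(\<Sum>i=0..<k. ?l i) = (\<Sum>i=k..<2*k. ?l i)"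
    by (simp add: sum_negf)
  then have "(\<Prod>i=0..<k. exp (?l i)) = (\<Prod>i=k..<2*k. exp (?l i))"
    by (simp add: exp_sum[symmetric])
  then have "(\<Prod>i=0..<k. real_of_rat (x (u i))) = (\<Prod>i=k..<2*k. real_of_rat (x (u i)))"
    using assms(1) by simp
  then show ?thesis
    by (simp only: of_rat_prod[symmetric] of_rat_eq_iff lessThan_atLeast0)
qed

text \<open>The coincidence argument needs \<open>p\<close>-integral terms, so negative valuations
  stay together in one block. The constant is 2 from this split times \<open>2 * k^2\<close> from
  the union bound.\<close>

lemma mean_sq_norm_one_prime:
  assumes "prime p" "finite A" "k \<ge> 1"
    and A: "\<And>a. a \<in> A \<Longrightarrow> 0 \<le> w a \<and> n a \<noteq> 0 \<and> 0 < n a + 1"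
  defines "\<theta> \<equiv> \<lambda>a. ln (real_of_rat (n a + 1))" and "v \<equiv> \<lambda>a. padic_val p (n a)"
  shows "mean_sq_norm k w \<theta> A \<le> 4 * real k ^ 2 *
    (mean_sq_norm k w \<theta> {a \<in> A. v a < 0} +
     (\<Sum>c\<in>v ` {a \<in> A. 0 \<le> v a}. mean_sq_norm k w \<theta> {a \<in> A. v a = c}))"
proof -
  let ?P = "{a \<in> A. 0 \<le> v a}"
  let ?N = "mean_sq_norm k w \<theta>"
  have coin: "\<exists>r s. r < s \<and> s < 2 * k \<and> v (u r) = v (u s)"
    if u: "u \<in> {..<2*k} \<rightarrow> ?P" and res: "resonant k \<theta> u" for u
  proof -
    have un: "{..<k} \<union> {k..<2*k} = {..<2*k}" by auto
    have uP: "u i \<in> A" "0 \<le> v (u i)" if "i < 2 * k" for i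
      using u that by auto
    have "(\<Prod>i<k. n (u i) + 1) = (\<Prod>i=k..<2*k. n (u i) + 1)"
      using resonant_prod_eq[of k "\<lambda>a. n a + 1" u] res uP A by (simp add: \<theta>_def)
    then have "(\<Prod>i<k. 1 + n (u i)) = (\<Prod>i=k..<2*k. 1 + n (u i))"
      by (simp add: add.commute)
    then have "\<exists>r\<in>{..<k} \<union> {k..<2*k}. \<exists>s\<in>{..<k} \<union> {k..<2*k}. r \<noteq> s \<and> v (u r) = v (u s)"
      unfolding v_def using assms(1,3) uP A by (intro ex_equal_padic_val) (auto simp: v_def)
    then obtain r s where "r < 2 * k" "s < 2 * k" "r \<noteq> s" "v (u r) = v (u s)"
      unfolding un by auto
    then show ?thesis by (metis linorder_neqE_nat)
  qed
  have "?N A \<le> 2 * (?N {a \<in> A. v a < 0} + ?N {a \<in> A. \<not> v a < 0})"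
    using assms(2,3) by (rule mean_sq_norm_split)
  also have "{a \<in> A. \<not> v a < 0} = ?P" by auto
  also have "?N ?P \<le> 2 * real k ^ 2 * (\<Sum>c\<in>v ` ?P. ?N {a \<in> ?P. v a = c})"
    using assms(2,3) A coin by (intro mean_sq_norm_le_of_coincidence) auto
  also have "(\<Sum>c\<in>v ` ?P. ?N {a \<in> ?P. v a = c}) = (\<Sum>c\<in>v ` ?P. ?N {a \<in> A. v a = c})"
    by (intro sum.cong refl arg_cong[where f = ?N]) auto
  finally have "?N A \<le> 2 * ?N {a \<in> A. v a < 0} + 4 * real k ^ 2 * (\<Sum>c\<in>v ` ?P. ?N {a \<in> A. v a = c})"
    by (simp add: algebra_simps)
  \<comment> \<open>The negative block only costs a factor 2; it is enlarged so that one constant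
    serves both parts.\<close>
  also have "2 * ?N {a \<in> A. v a < 0} \<le> 4 * real k ^ 2 * ?N {a \<in> A. v a < 0}"
  proof (rule mult_right_mono)
    have "1 \<le> real k ^ 2" using assms(3) by simp
    then show "2 \<le> 4 * real k ^ 2" by linarith
  qed (rule mean_sq_norm_nonneg)
  finally show ?thesis by (simp add: algebra_simps)
qed

subsection \<open>Induction on the number of primes\<close>

text \<open>The subsets of \<open>{1..K+1}\<close> are sorted by whether they contain
  \<open>K+1\<close>. Without it the last entry is negative and unrecorded; with it the projection
  also records that entry as a value \<open>c \<ge> 0\<close>.\<close>

lemma fibre_sum_Suc:
  fixes Q :: "(nat \<Rightarrow> int) set \<Rightarrow> real"
  assumes "finite J"
  defines "T \<equiv> \<lambda>K J. \<Sum>S\<in>Pow {1..K}. \<Sum>jS\<in>(\<lambda>j. restrict j S) ` nonneg_exactly K J S. Q (fibre K J S jS)"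
  shows "T (Suc K) J = T K {j \<in> J. j (Suc K) < 0} +
    (\<Sum>c\<in>(\<lambda>j. j (Suc K)) ` {j \<in> J. 0 \<le> j (Suc K)}. T K {j \<in> J. j (Suc K) = c})"
proof -
  let ?n = "Suc K"
  let ?C = "(\<lambda>j. j ?n) ` {j \<in> J. 0 \<le> j ?n}"
  let ?J = "\<lambda>c. {j \<in> J. j ?n = c}"
  let ?\<Phi> = "\<lambda>K J S. \<Sum>jS\<in>(\<lambda>j. restrict j S) ` nonneg_exactly K J S. Q (fibre K J S jS)"
  have ins: "{1..?n} = insert ?n {1..K}" by auto
  have inj: "inj_on (insert ?n) (Pow {1..K})"
    by (rule inj_onI) (auto simp: set_eq_iff; metis Suc_n_not_le_n atLeastAtMost_iff insert_iff subsetD)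
  have neg: "?\<Phi> ?n J S = ?\<Phi> K {j \<in> J. j ?n < 0} S" if "S \<in> Pow {1..K}" for S
  proof -
    have "{1..?n} - S = insert ?n ({1..K} - S)" using that by auto
    then have "nonneg_exactly ?n J S = nonneg_exactly K {j \<in> J. j ?n < 0} S"
      "fibre ?n J S = fibre K {j \<in> J. j ?n < 0} S"
      by (auto simp: nonneg_exactly_def fibre_def fun_eq_iff)
    then show ?thesis by simp
  qed
  have pos: "?\<Phi> ?n J (insert ?n S) = (\<Sum>c\<in>?C. ?\<Phi> K (?J c) S)" if "S \<in> Pow {1..K}" for S
  proof -
    have S: "?n \<notin> S" using that by auto
    have compl: "{1..?n} - insert ?n S = {1..K} - S" using that by auto
    have restr: "restrict j (insert ?n S) = (restrict j S)(?n := j ?n)" for j :: "nat \<Rightarrow> int"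
      by (auto simp: restrict_def)
    have nn: "nonneg_exactly ?n J (insert ?n S) = (\<Union>c\<in>?C. nonneg_exactly K (?J c) S)"
      unfolding nonneg_exactly_def compl by auto
    \<comment> \<open>Restrictions to \<open>S\<close> are undefined at \<open>?n\<close>, so
      \<open>g(?n := c)\<close> determines both \<open>g\<close> and \<open>c\<close>.\<close>
    have fib: "fibre ?n J (insert ?n S) (g(?n := c)) = fibre K (?J c) S g" if "g ?n = undefined" for g c
    proof -
      have "restrict j (insert ?n S) = g(?n := c) \<longleftrightarrow> restrict j S = g \<and> j ?n = c" for j
      proof
        assume eq: "restrict j (insert ?n S) = g(?n := c)"
        have "restrict j S i = g i" for i
          using fun_cong[OF eq, of i] S that by (cases "i = ?n") (auto simp: restrict_def split: if_splits)
        moreover have "j ?n = c" using fun_cong[OF eq, of ?n] by simp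
        ultimately show "restrict j S = g \<and> j ?n = c" by blast
      next
        assume "restrict j S = g \<and> j ?n = c"
        then show "restrict j (insert ?n S) = g(?n := c)" using restr[of j] by metis
      qed
      then show ?thesis unfolding fibre_def compl by auto
    qed
    have "(\<Sum>c\<in>?C. ?\<Phi> K (?J c) S) =
      (\<Sum>(c, g)\<in>(SIGMA c:?C. (\<lambda>j. restrict j S) ` nonneg_exactly K (?J c) S). Q (fibre K (?J c) S g))"
      using assms(1) by (intro sum.Sigma) (auto simp: nonneg_exactly_def)
    also have "\<dots> = ?\<Phi> ?n J (insert ?n S)"
    \<comment> \<open>A projection onto \<open>insert ?n S\<close> corresponds to its value at
      \<open>?n\<close> together with its restriction to \<open>S\<close>.\<close>
    proof (rule sum.reindex_bij_witness[where i = "\<lambda>h. (h ?n, restrict h S)" and j = "\<lambda>(c, g). g(?n := c)"])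
      fix a assume a: "a \<in> (SIGMA c:?C. (\<lambda>j. restrict j S) ` nonneg_exactly K (?J c) S)"
      then obtain c j where cj: "a = (c, restrict j S)" "c \<in> ?C" "j \<in> nonneg_exactly K (?J c) S"
        by blast
      have jc: "j ?n = c" using cj by (simp add: nonneg_exactly_def)
      show "((case a of (c, g) \<Rightarrow> g(?n := c)) ?n, restrict (case a of (c, g) \<Rightarrow> g(?n := c)) S) = a"
        using S by (auto simp: cj(1) restrict_def)
      have "(case a of (c, g) \<Rightarrow> g(?n := c)) = restrict j (insert ?n S)"
        by (simp add: cj(1) restr jc)
      moreover have "j \<in> nonneg_exactly ?n J (insert ?n S)" unfolding nn using cj by blast
      ultimately show "(case a of (c, g) \<Rightarrow> g(?n := c)) \<in>
          (\<lambda>j. restrict j (insert ?n S)) ` nonneg_exactly ?n J (insert ?n S)" by blast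
      show "Q (fibre ?n J (insert ?n S) (case a of (c, g) \<Rightarrow> g(?n := c))) =
          (case a of (c, g) \<Rightarrow> Q (fibre K (?J c) S g))"
        unfolding cj(1) prod.case using S by (subst fib) simp_all
    next
      fix h assume "h \<in> (\<lambda>j. restrict j (insert ?n S)) ` nonneg_exactly ?n J (insert ?n S)"
      then obtain j c where j: "h = restrict j (insert ?n S)" "c \<in> ?C" "j \<in> nonneg_exactly K (?J c) S"
        unfolding nn by blast
      have jc: "j ?n = c" using j by (simp add: nonneg_exactly_def)
      have h: "h ?n = c" "restrict h S = restrict j S"
        using jc by (auto simp: j(1) restrict_def)
      show "(case (h ?n, restrict h S) of (c, g) \<Rightarrow> g(?n := c)) = h"
        unfolding prod.case h unfolding j(1) restr jc ..
      show "(h ?n, restrict h S) \<in> (SIGMA c:?C. (\<lambda>j. restrict j S) ` nonneg_exactly K (?J c) S)"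
        using j h by blast
    qed
    finally show ?thesis by simp
  qed
  have "T ?n J = (\<Sum>S\<in>Pow {1..K}. ?\<Phi> ?n J S) + (\<Sum>S\<in>insert ?n ` Pow {1..K}. ?\<Phi> ?n J S)"
    unfolding T_def ins Pow_insert
    by (rule sum.union_disjoint) auto
  also have "(\<Sum>S\<in>insert ?n ` Pow {1..K}. ?\<Phi> ?n J S) = (\<Sum>S\<in>Pow {1..K}. ?\<Phi> ?n J (insert ?n S))"
    by (simp only: sum.reindex[OF inj] o_def)
  also have "\<dots> = (\<Sum>S\<in>Pow {1..K}. \<Sum>c\<in>?C. ?\<Phi> K (?J c) S)"
    by (intro sum.cong refl pos)
  also have "\<dots> = (\<Sum>c\<in>?C. T K (?J c))"
    unfolding T_def by (rule sum.swap)
  also have "(\<Sum>S\<in>Pow {1..K}. ?\<Phi> ?n J S) = T K {j \<in> J. j ?n < 0}"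
    unfolding T_def by (intro sum.cong refl neg)
  finally show ?thesis .
qed

text \<open>The induction is purely combinatorial, hence an arbitrary set function \<open>Q\<close>.
  Splitting along the last coordinate costs one factor \<open>C\<close>; the one-coordinate bound
  holds for all subsets of \<open>J\<close>, so it is inherited by the negative part and by every
  slice.\<close>

lemma fibre_sum_bound:
  fixes Q :: "(nat \<Rightarrow> int) set \<Rightarrow> real"
  assumes "finite J" "0 \<le> C" "Q {} = 0"
    and "\<And>i J'. i \<in> {1..K} \<Longrightarrow> J' \<subseteq> J \<Longrightarrow>
      Q J' \<le> C * (Q {j \<in> J'. j i < 0} +
        (\<Sum>c\<in>(\<lambda>j. j i) ` {j \<in> J'. 0 \<le> j i}. Q {j \<in> J'. j i = c}))"
  shows "Q J \<le> C ^ K *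
    (\<Sum>S\<in>Pow {1..K}. \<Sum>jS\<in>(\<lambda>j. restrict j S) ` nonneg_exactly K J S. Q (fibre K J S jS))"
  using assms(1,4)
proof (induction K arbitrary: J)
  \<comment> \<open>Only the empty \<open>S\<close> remains. If \<open>J\<close> is nonempty, its
    sole projection has fibre \<open>J\<close>; if \<open>J\<close> is empty the sum is empty and
    \<open>Q {} = 0\<close> is used.\<close>
  case 0
  show ?case
  proof (cases "J = {}")
    case True
    then show ?thesis by (simp add: nonneg_exactly_def assms(3))
  next
    case False
    then have "(\<lambda>j. restrict j {}) ` J = {\<lambda>_. undefined}"
      by (auto simp: restrict_def)
    then show ?thesis
      by (simp add: nonneg_exactly_def fibre_def restrict_def)
  qed
next
  case (Suc K)
  let ?n = "Suc K"
  let ?T = "\<lambda>K J. \<Sum>S\<in>Pow {1..K}. \<Sum>jS\<in>(\<lambda>j. restrict j S) ` nonneg_exactly K J S. Q (fibre K J S jS)"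
  have IH: "Q J' \<le> C ^ K * ?T K J'" if "J' \<subseteq> J" for J'
    using that Suc.prems finite_subset by (intro Suc.IH) auto
  have "Q J \<le> C * (Q {j \<in> J. j ?n < 0} + (\<Sum>c\<in>(\<lambda>j. j ?n) ` {j \<in> J. 0 \<le> j ?n}. Q {j \<in> J. j ?n = c}))"
    by (rule Suc.prems(2)) auto
  also have "\<dots> \<le> C * (C ^ K * ?T K {j \<in> J. j ?n < 0} +
      (\<Sum>c\<in>(\<lambda>j. j ?n) ` {j \<in> J. 0 \<le> j ?n}. C ^ K * ?T K {j \<in> J. j ?n = c}))"
    using assms(2) by (intro mult_left_mono add_mono sum_mono IH) auto
  also have "\<dots> = C ^ ?n * (?T K {j \<in> J. j ?n < 0} +
      (\<Sum>c\<in>(\<lambda>j. j ?n) ` {j \<in> J. 0 \<le> j ?n}. ?T K {j \<in> J. j ?n = c}))"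
    by (simp only: sum_distrib_left[symmetric] distrib_left[symmetric] power_Suc mult.assoc)
  also have "\<dots> = C ^ ?n * ?T ?n J"
    by (simp only: fibre_sum_Suc[OF Suc.prems(1)])
  finally show ?case .
qed

section \<open>Application to Dirichlet polynomials\<close>

theorem theorem17:
  fixes K k :: nat
    and p :: "nat \<Rightarrow> nat"
    and J :: "(nat \<Rightarrow> int) set"
    and f :: "(nat \<Rightarrow> int) \<Rightarrow> real \<Rightarrow> complex"
  assumes "\<forall>i\<in>{1..K}. prime (p i)"
    and "finite J"
    and "J \<subseteq> {1..K} \<rightarrow>\<^sub>E UNIV"
    and "\<forall>j\<in>J. f j \<in> dirichlet_polys K p j 1"
    and "k \<ge> 1"
  shows "(\<exists>L. (moment k (\<lambda>t. \<Sum>j\<in>J. f j t) \<longlongrightarrow> L) at_top) \<and>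
    (\<forall>S\<in>Pow {1..K}. \<forall>jS\<in>(\<lambda>j. restrict j S) ` nonneg_exactly K J S.
       \<exists>L. (moment k (\<lambda>t. \<Sum>j\<in>fibre K J S jS. f j t) \<longlongrightarrow> L) at_top) \<and>
    Lim at_top (moment k (\<lambda>t. \<Sum>j\<in>J. f j t))
      \<le> (4 * real k ^ 2) ^ K *
         (\<Sum>S\<in>Pow {1..K}. \<Sum>jS\<in>(\<lambda>j. restrict j S) ` nonneg_exactly K J S.
            Lim at_top (moment k (\<lambda>t. \<Sum>j\<in>fibre K J S jS. f j t)))"
proof -
  have "\<forall>j\<in>J. \<exists>N w. finite N \<and>
           (\<forall>n\<in>N. \<forall>i\<in>{1..K}. n \<noteq> 0 \<and> padic_val (p i) n = j i) \<and>
           (\<forall>n\<in>N. 0 < n + 1) \<and> (\<forall>n\<in>N. 0 \<le> w n) \<and>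
           f j = (\<lambda>t. \<Sum>n\<in>N. complex_of_real (w n) * exp (\<i> * complex_of_real (t * ln (real_of_rat (n + 1)))))"
    using assms(4) unfolding dirichlet_polys_def by blast
  from bchoice[OF this] obtain N where "\<forall>j\<in>J. \<exists>w. finite (N j) \<and>
           (\<forall>n\<in>N j. \<forall>i\<in>{1..K}. n \<noteq> 0 \<and> padic_val (p i) n = j i) \<and>
           (\<forall>n\<in>N j. 0 < n + 1) \<and> (\<forall>n\<in>N j. 0 \<le> w n) \<and>
           f j = (\<lambda>t. \<Sum>n\<in>N j. complex_of_real (w n) * exp (\<i> * complex_of_real (t * ln (real_of_rat (n + 1)))))"
    by blast
  from bchoice[OF this] obtain W where "\<forall>j\<in>J. finite (N j) \<and>
           (\<forall>n\<in>N j. \<forall>i\<in>{1..K}. n \<noteq> 0 \<and> padic_val (p i) n = j i) \<and>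
           (\<forall>n\<in>N j. 0 < n + 1) \<and> (\<forall>n\<in>N j. 0 \<le> W j n) \<and>
           f j = (\<lambda>t. \<Sum>n\<in>N j. complex_of_real (W j n) * exp (\<i> * complex_of_real (t * ln (real_of_rat (n + 1)))))"
    by blast
  then have NW: "\<And>j. j \<in> J \<Longrightarrow> finite (N j)"
    "\<And>j n i. j \<in> J \<Longrightarrow> n \<in> N j \<Longrightarrow> i \<in> {1..K} \<Longrightarrow> n \<noteq> 0 \<and> padic_val (p i) n = j i"
    "\<And>j n. j \<in> J \<Longrightarrow> n \<in> N j \<Longrightarrow> 0 < n + 1 \<and> 0 \<le> W j n"
    "\<And>j. j \<in> J \<Longrightarrow> f j = (\<lambda>t. \<Sum>n\<in>N j. complex_of_real (W j n) *
        exp (\<i> * complex_of_real (t * ln (real_of_rat (n + 1)))))"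
    by blast+
  \<comment> \<open>Indices are pairs of a vector and a rational, so any partial sum over a set
    \<open>J'\<close> of vectors is a single trigonometric polynomial indexed by
    \<open>Sigma J' N\<close>.\<close>
  define w where "w = (\<lambda>(j, n). W j n)"
  define \<theta> where "\<theta> = (\<lambda>a :: (nat \<Rightarrow> int) \<times> rat. ln (real_of_rat (snd a + 1)))"
  define Q where "Q J' = mean_sq_norm k w \<theta> (Sigma J' N)" for J'
  have fin: "finite (Sigma J' N)" if "J' \<subseteq> J" for J'
    using that assms(2) NW(1) finite_subset by blast
  have lim: "(moment k (\<lambda>t. \<Sum>j\<in>J'. f j t) \<longlongrightarrow> Q J') at_top" if "J' \<subseteq> J" for J'
  proof -
    have "(\<lambda>t. \<Sum>j\<in>J'. f j t) = trig_poly w \<theta> (Sigma J' N)"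
    proof
      fix t
      have "(\<Sum>j\<in>J'. f j t) = (\<Sum>j\<in>J'. \<Sum>n\<in>N j. complex_of_real (W j n) *
        exp (\<i> * complex_of_real (t * ln (real_of_rat (n + 1)))))"
        using that NW(4) by (intro sum.cong refl) auto
      also have "\<dots> = trig_poly w \<theta> (Sigma J' N) t"
        unfolding trig_poly_def w_def \<theta>_def
        using that assms(2) NW(1) finite_subset by (subst sum.Sigma) (auto simp: case_prod_unfold)
      finally show "(\<Sum>j\<in>J'. f j t) = trig_poly w \<theta> (Sigma J' N) t" .
    qed
    then show ?thesis
      unfolding Q_def mean_sq_norm_def
      using moment_trig_poly_tendsto[OF fin[OF that] assms(5)] by simp
  qed
  \<comment> \<open>\<open>Lim\<close> denotes the limit only once convergence is known, which
    \<open>lim\<close> supplies for every subset of \<open>J\<close>.\<close>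
  have Lim_eq: "Lim at_top (moment k (\<lambda>t. \<Sum>j\<in>J'. f j t)) = Q J'" if "J' \<subseteq> J" for J'
    using lim[OF that] by (intro tendsto_Lim) auto
  have fibre_sub: "fibre K J S jS \<subseteq> J" for S jS by (auto simp: fibre_def)
  have "Q J \<le> (4 * real k ^ 2) ^ K *
    (\<Sum>S\<in>Pow {1..K}. \<Sum>jS\<in>(\<lambda>j. restrict j S) ` nonneg_exactly K J S. Q (fibre K J S jS))"
  proof (rule fibre_sum_bound)
    show "Q {} = 0" using assms(5) by (simp add: Q_def mean_sq_norm_empty)
    fix i J' assume i: "i \<in> {1..K}" and J': "J' \<subseteq> J"
    let ?v = "\<lambda>a :: (nat \<Rightarrow> int) \<times> rat. padic_val (p i) (snd a)"
    \<comment> \<open>On these pairs the valuation of the rational is the coordinate of the vector,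
      so valuation classes of indices become coordinate classes of vectors.\<close>
    have v: "?v (j, n) = j i" if "j \<in> J'" "n \<in> N j" for j n
      using that NW(2)[of j n i] i J' by auto
    have "Q J' \<le> 4 * real k ^ 2 *
      (mean_sq_norm k w \<theta> {a \<in> Sigma J' N. ?v a < 0} +
       (\<Sum>c\<in>?v ` {a \<in> Sigma J' N. 0 \<le> ?v a}. mean_sq_norm k w \<theta> {a \<in> Sigma J' N. ?v a = c}))"
      unfolding Q_def \<theta>_def
    proof (rule mean_sq_norm_one_prime)
      show "0 \<le> w a \<and> snd a \<noteq> 0 \<and> 0 < snd a + 1" if "a \<in> Sigma J' N" for a
        using that NW(2)[of "fst a" "snd a" i] NW(3)[of "fst a" "snd a"] i J' by (auto simp: w_def)
    qed (use assms i fin[OF J'] in auto)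
    also have "{a \<in> Sigma J' N. ?v a < 0} = Sigma {j \<in> J'. j i < 0} N"
      using v by auto
    also have "(\<Sum>c\<in>?v ` {a \<in> Sigma J' N. 0 \<le> ?v a}. mean_sq_norm k w \<theta> {a \<in> Sigma J' N. ?v a = c})
        = (\<Sum>c\<in>?v ` {a \<in> Sigma J' N. 0 \<le> ?v a}. Q {j \<in> J'. j i = c})"
      unfolding Q_def using v by (intro sum.cong refl arg_cong[where f = "mean_sq_norm k w \<theta>"]) auto
    \<comment> \<open>Only an inequality: a vector with empty \<open>N j\<close> may contribute a
      coordinate value that no index attains. The additional terms are non-negative.\<close>
    also have "\<dots> \<le> (\<Sum>c\<in>(\<lambda>j. j i) ` {j \<in> J'. 0 \<le> j i}. Q {j \<in> J'. j i = c})"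
    proof (rule sum_mono2)
      show "finite ((\<lambda>j. j i) ` {j \<in> J'. 0 \<le> j i})"
        using finite_subset[OF J' assms(2)] by simp
      show "?v ` {a \<in> Sigma J' N. 0 \<le> ?v a} \<subseteq> (\<lambda>j. j i) ` {j \<in> J'. 0 \<le> j i}"
        using v by force
    qed (simp add: Q_def mean_sq_norm_nonneg)
    finally show "Q J' \<le> 4 * real k ^ 2 * (Q {j \<in> J'. j i < 0} +
        (\<Sum>c\<in>(\<lambda>j. j i) ` {j \<in> J'. 0 \<le> j i}. Q {j \<in> J'. j i = c}))"
      by (simp add: Q_def[of "{j \<in> J'. j i < 0}"] mult_left_mono)
  qed (use assms in auto)
  then show ?thesis
    unfolding Lim_eq[OF fibre_sub] Lim_eq[OF order_refl] using lim[OF fibre_sub] lim[OF order_refl] by blast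
qed

end
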